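(* Let $\alpha\in(0,1)$ and $i\in(0,1)$. The mean-quantile valuation $\rho$, defined for $S\in\mathcal{C}$ by $$\rho(S)=\boldsymbol{\theta}_S\cdot\mathbf{y}+i\,\boldsymbol{\eta}_S\cdot\mathbf{y},$$ $$\boldsymbol{\theta}_S=\arg\min_{\boldsymbol{\beta}\in\mathcal{B}}\mathbb{E}\left[(S-\boldsymbol{\beta}\cdot\mathbf{Y})^2\right],\qquad \boldsymbol{\eta}_S=\arg\min_{\boldsymbol{\beta}\in\mathcal{B}}\mathbb{E}\left[\ell_\alpha(S-\boldsymbol{\theta}_S\cdot\mathbf{Y}-\boldsymbol{\beta}\cdot\mathbf{Y})\right],$$ where $\ell_\alpha(x)=\frac{\alpha}{1-\alpha}\max(x,0)+\max(-x,0)$, is positive homogeneous and fair.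
   Context: One-period market. $(\Omega,\mathcal{F},\mathbb{P})$ is a probability space and $\mathcal{C}\subseteq L^2(\Omega,\mathcal{F},\mathbb{P})$ is the set of all claims with maturity $1$. There is a risk-free asset (asset $0$) with deterministic interest rate $r\ge 0$ and $n$ risky assets. Asset values at time $0$ are $\mathbf{y}=(1,y_1,\ldots,y_n)$ with $y_k\ge 0$, and at time $1$ they are $\mathbf{Y}=(Y_0,Y_1,\ldots,Y_n)$ with $Y_0=e^r$ and $Y_k\in\mathcal{C}$ for $k=1,\ldots,n$. The set of trading strategies is $\mathcal{B}=\mathbb{R}^{n+1}$; a strategy $\boldsymbol{\beta}=(\beta_0,\ldots,\beta_n)$ has value $\boldsymbol{\beta}\cdot\mathbf{y}=\sum_{k=0}^n\beta_k y_k$ at time $0$ and $\boldsymbol{\beta}\cdot\mathbf{Y}=\sum_{k=0}^n\beta_k Y_k$ at time $1$. Assets are non-redundant: $\boldsymbol{\beta}\cdot\mathbf{Y}=0$ if and only if $\boldsymbol{\beta}=(0,\ldots,0)$ (relations between random variables hold $\mathbb{P}$-almost surely); this ensures that the quadratic minimisation problem has a unique solution. A claim is hedgeable if it equals $\boldsymbol{\beta}\cdot\mathbf{Y}$ for some $\boldsymbol{\beta}\in\mathcal{B}$. $\mathcal{C}^\perp\subseteq\mathcal{C}$ is the class of claims independent of the vector $\mathbf{Y}$. The constant $i$ is the cost-of-capital rate. The strategy $\boldsymbol{\theta}_S$ is called the quadratic hedging strategy for $S$, and $\boldsymbol{\eta}_S$ the quantile hedging strategy for the residual risk $S-\boldsymbol{\theta}_S\cdot\mathbf{Y}$,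 i.e. the strategy that minimises the expected loss $\ell_\alpha$. A valuation is a mapping $\rho:\mathcal{C}\to\mathbb{R}$ with $\rho(0)=0$ and $\rho(S+a)=\rho(S)+e^{-r}a$ for all $S\in\mathcal{C}$, $a\in\mathbb{R}$. A valuation $\rho$ is: - positive homogeneous if $\rho(\lambda S)=\lambda\rho(S)$ for any $S\in\mathcal{C}$ and any $\lambda\ge 0$; - market-consistent if $\rho(S+S^h)=\rho(S)+\boldsymbol{\beta}\cdot\mathbf{y}$ for any $S\in\mathcal{C}$ and any hedgeable payoff $S^h=\boldsymbol{\beta}\cdot\mathbf{Y}$; - actuarial if $\rho(S^\perp)=e^{-r}\mathbb{E}[S^\perp]+\mathrm{RM}(S^\perp)$ for any claim $S^\perp\in\mathcal{C}^\perp$, where $\mathrm{RM}:\mathcal{C}^\perp\to\mathbb{R}$ is a mapping that does not depend on the current asset prices $\mathbf{y}$; - fair if it is market-consistent and actuarial.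
   Formalization: The quantile hedging problem can have several minimisers (e.g. α = 1/2 and S = ±1 equally likely, independent of Y), so η_S and ρ(S) are then undefined; the formal statement assumes that η_S is unique for each claim S in C. Existence of η_S is proved. *)

theory Defs
  imports "HOL-Probability.Probability"
begin

text \<open>
  Vectors indexed by the assets \<open>0, \<dots>, n\<close> (strategies, prices, payoffs) have type
  \<open>real \<times> (real ^ 'n)\<close> with \<open>n = CARD('n)\<close>: the first component belongs to the risk-free asset.
  The inner product of this type is the sum over all \<open>n + 1\<close> assets.
\<close>

definition square_integrable :: "'a measure \<Rightarrow> ('a \<Rightarrow> real) set" where
  "square_integrable M = {X \<in> borel_measurable M. integrable M (\<lambda>\<omega>. (X \<omega>)\<^sup>2)}"

definition asset_values :: "real \<Rightarrow> ('n::finite \<Rightarrow> 'a \<Rightarrow> real) \<Rightarrow> 'a \<Rightarrow> real \<times> (real ^ 'n)" where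
  "asset_values r R \<omega> = (exp r, \<chi> k. R k \<omega>)"

definition price_vectors :: "(real \<times> (real ^ 'n::finite)) set" where
  "price_vectors = {y. fst y = 1 \<and> (\<forall>k. 0 \<le> snd y $ k)}"

text \<open>
  Claims are represented by functions and relations between them hold almost surely. No closure
  property of the set \<open>C\<close> of claims is required: the valuations below are given on all random
  variables, and their properties are stated for claims in \<open>C\<close>.
\<close>

locale market = prob_space M for M :: "'a measure" +
  fixes C :: "('a \<Rightarrow> real) set"
    and r :: real
    and R :: "'n::finite \<Rightarrow> 'a \<Rightarrow> real"
  assumes claims: "C \<subseteq> square_integrable M"
    and rate: "0 \<le> r"
    and risky_assets: "\<And>k. R k \<in> C"
    and non_redundant:
      "\<And>\<beta>. (AE \<omega> in M. \<beta> \<bullet> asset_values r R \<omega> = 0) \<longleftrightarrow> \<beta> = 0"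

definition hedged_by ::
    "'a measure \<Rightarrow> ('a \<Rightarrow> real \<times> (real ^ 'n::finite)) \<Rightarrow> ('a \<Rightarrow> real) \<Rightarrow> real \<times> (real ^ 'n) \<Rightarrow> bool" where
  "hedged_by M Y H \<beta> \<longleftrightarrow> H \<in> borel_measurable M \<and> (AE \<omega> in M. H \<omega> = \<beta> \<bullet> Y \<omega>)"

text \<open>
  Independence of \<open>S\<close> and the vector \<open>Y\<close>, written out because \<^const>\<open>prob_space.indep_var\<close>
  needs both random variables to have values in the same type.
\<close>

definition orthogonal_claims ::
    "'a measure \<Rightarrow> ('a \<Rightarrow> real) set \<Rightarrow> ('a \<Rightarrow> real \<times> (real ^ 'n::finite)) \<Rightarrow> ('a \<Rightarrow> real) set" where
  "orthogonal_claims M C Y =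
    {S \<in> C. prob_space.indep_set M
       {S -` A \<inter> space M | A. A \<in> sets borel}
       {Y -` B \<inter> space M | B. B \<in> sets borel}}"

definition valuation :: "('a \<Rightarrow> real) set \<Rightarrow> real \<Rightarrow> (('a \<Rightarrow> real) \<Rightarrow> real) \<Rightarrow> bool" where
  "valuation C r \<rho> \<longleftrightarrow>
    \<rho> (\<lambda>\<omega>. 0) = 0 \<and> (\<forall>S\<in>C. \<forall>a. \<rho> (\<lambda>\<omega>. S \<omega> + a) = \<rho> S + exp (- r) * a)"

definition positive_homogeneous :: "('a \<Rightarrow> real) set \<Rightarrow> (('a \<Rightarrow> real) \<Rightarrow> real) \<Rightarrow> bool" where
  "positive_homogeneous C \<rho> \<longleftrightarrow>
    (\<forall>S\<in>C. \<forall>c\<ge>0. \<rho> (\<lambda>\<omega>. c * S \<omega>) = c * \<rho> S)"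

definition market_consistent ::
    "'a measure \<Rightarrow> ('a \<Rightarrow> real) set \<Rightarrow> ('a \<Rightarrow> real \<times> (real ^ 'n::finite)) \<Rightarrow> real \<times> (real ^ 'n)
      \<Rightarrow> (('a \<Rightarrow> real) \<Rightarrow> real) \<Rightarrow> bool" where
  "market_consistent M C Y y \<rho> \<longleftrightarrow>
    (\<forall>S\<in>C. \<forall>H \<beta>. hedged_by M Y H \<beta> \<longrightarrow> \<rho> (\<lambda>\<omega>. S \<omega> + H \<omega>) = \<rho> S + \<beta> \<bullet> y)"

text \<open>
  That the risk margin does not depend on the current asset prices is expressed by regarding
  a valuation as a family indexed by the price vector \<open>y\<close>, with one risk margin for all \<open>y\<close>.
\<close>

definition actuarial ::
    "'a measure \<Rightarrow> ('a \<Rightarrow> real) set \<Rightarrow> real \<Rightarrow> ('a \<Rightarrow> real \<times> (real ^ 'n::finite))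
      \<Rightarrow> (real \<times> (real ^ 'n) \<Rightarrow> ('a \<Rightarrow> real) \<Rightarrow> real) \<Rightarrow> bool" where
  "actuarial M C r Y \<rho> \<longleftrightarrow>
    (\<exists>RM. \<forall>y\<in>price_vectors. \<forall>S\<in>orthogonal_claims M C Y.
       \<rho> y S = exp (- r) * (\<integral>\<omega>. S \<omega> \<partial>M) + RM S)"

definition fair ::
    "'a measure \<Rightarrow> ('a \<Rightarrow> real) set \<Rightarrow> real \<Rightarrow> ('a \<Rightarrow> real \<times> (real ^ 'n::finite))
      \<Rightarrow> (real \<times> (real ^ 'n) \<Rightarrow> ('a \<Rightarrow> real) \<Rightarrow> real) \<Rightarrow> bool" where
  "fair M C r Y \<rho> \<longleftrightarrow>
    (\<forall>y\<in>price_vectors. market_consistent M C Y y (\<rho> y)) \<and> actuarial M C r Y \<rho>"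

definition quadratic_hedge ::
    "'a measure \<Rightarrow> ('a \<Rightarrow> real \<times> (real ^ 'n::finite)) \<Rightarrow> ('a \<Rightarrow> real) \<Rightarrow> real \<times> (real ^ 'n)" where
  "quadratic_hedge M Y S = arg_min (\<lambda>\<beta>. \<integral>\<omega>. (S \<omega> - \<beta> \<bullet> Y \<omega>)\<^sup>2 \<partial>M) (\<lambda>_. True)"

definition quantile_loss :: "real \<Rightarrow> real \<Rightarrow> real" where
  "quantile_loss \<alpha> x = \<alpha> / (1 - \<alpha>) * max x 0 + max (- x) 0"

definition expected_residual_loss ::
    "'a measure \<Rightarrow> ('a \<Rightarrow> real \<times> (real ^ 'n::finite)) \<Rightarrow> real \<Rightarrow> ('a \<Rightarrow> real) \<Rightarrow> real \<times> (real ^ 'n) \<Rightarrow> real" where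
  "expected_residual_loss M Y \<alpha> S \<beta> =
    (\<integral>\<omega>. quantile_loss \<alpha> (S \<omega> - quadratic_hedge M Y S \<bullet> Y \<omega> - \<beta> \<bullet> Y \<omega>) \<partial>M)"

definition quantile_hedge ::
    "'a measure \<Rightarrow> ('a \<Rightarrow> real \<times> (real ^ 'n::finite)) \<Rightarrow> real \<Rightarrow> ('a \<Rightarrow> real) \<Rightarrow> real \<times> (real ^ 'n)" where
  "quantile_hedge M Y \<alpha> S = arg_min (expected_residual_loss M Y \<alpha> S) (\<lambda>_. True)"

definition mean_quantile_valuation ::
    "'a measure \<Rightarrow> ('a \<Rightarrow> real \<times> (real ^ 'n::finite)) \<Rightarrow> real \<Rightarrow> real
      \<Rightarrow> real \<times> (real ^ 'n) \<Rightarrow> ('a \<Rightarrow> real) \<Rightarrow> real" where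
  "mean_quantile_valuation M Y \<alpha> i y S =
    quadratic_hedge M Y S \<bullet> y + i * (quantile_hedge M Y \<alpha> S \<bullet> y)"

text \<open>
  The quantile hedging problem always has a minimiser, but non-redundancy does not make it
  unique (quantiles need not be unique). Where it is not, \<open>arg_min\<close> makes an arbitrary choice
  and the mean-quantile valuation is not well defined. The following condition is what makes
  it well defined on \<open>C\<close>; as \<open>C\<close> need not be closed under any operation, it may be
  the set of all square-integrable claims whose quantile hedge is unique.
\<close>

definition unique_quantile_hedges ::
    "'a measure \<Rightarrow> ('a \<Rightarrow> real) set \<Rightarrow> ('a \<Rightarrow> real \<times> (real ^ 'n::finite)) \<Rightarrow> real \<Rightarrow> bool" where
  "unique_quantile_hedges M C Y \<alpha> \<longleftrightarrow>
    (\<forall>S\<in>C. \<exists>\<^sub>\<le>\<^sub>1 \<beta>. is_arg_min (expected_residual_loss M Y \<alpha> S) (\<lambda>_. True) \<beta>)"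

end

theory Submission
  imports Defs
begin

text \<open>
  The quadratic hedge solves the normal equations, whose Gram operator is injective by
  non-redundancy. Both hedges are therefore compatible with scaling, and adding a hedgeable payoff
  shifts the quadratic hedge and leaves the residual risk unchanged. The quantile hedge exists
  because the expected loss is Lipschitz and coercive in the strategy. If \<open>S\<close> is independent of
  the assets, then replacing the payoff of any strategy by its (risk-free) mean does not increase
  the expected loss, by Jensen's inequality conditionally on \<open>S\<close>; so both hedges of \<open>S\<close> are
  risk-free and have a value that does not depend on the prices of the risky assets.
\<close>

section \<open>The quantile loss\<close>

text \<open>The loss is convex and piecewise linear with slopes -1 and \<alpha> / (1 - \<alpha>), so
  every tangent line lies below it; at the kink the left slope is chosen. An explicit, bounded
  choice of slope serves the Lipschitz bound and, later, Jensen's inequality.\<close>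

lemma quantile_loss_subgradient:
  assumes "0 < \<alpha>" "\<alpha> < 1"
  shows "quantile_loss \<alpha> x + (if 0 < x then \<alpha> / (1 - \<alpha>) else - 1) * (u - x) \<le> quantile_loss \<alpha> u"
proof -
  define k where "k = \<alpha> / (1 - \<alpha>)"
  have "0 < k"
    using assms by (simp add: k_def)
  then have "k * u \<le> 0" if "u \<le> 0"
    using that by (simp add: mult_nonneg_nonpos)
  moreover have "0 \<le> k * u" if "0 \<le> u"
    using that \<open>0 < k\<close> by simp
  ultimately show ?thesis
    unfolding quantile_loss_def k_def[symmetric] by (auto simp: max_def algebra_simps)
qed

lemma quantile_loss_lipschitz:
  assumes "0 < \<alpha>" "\<alpha> < 1"
  shows "\<bar>quantile_loss \<alpha> x - quantile_loss \<alpha> u\<bar> \<le> (\<alpha> / (1 - \<alpha>) + 1) * \<bar>x - u\<bar>"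
proof -
  have k: "0 < \<alpha> / (1 - \<alpha>)"
    using assms by simp
  \<comment> \<open>The tangent line at \<open>a\<close> gives a one-sided bound; using it in both
    orders gives the absolute value. The sum of the absolute slopes serves as a constant that
    dominates either of them.\<close>
  have "quantile_loss \<alpha> a - quantile_loss \<alpha> b \<le> (\<alpha> / (1 - \<alpha>) + 1) * \<bar>a - b\<bar>" for a b
  proof -
    let ?s = "if 0 < a then \<alpha> / (1 - \<alpha>) else - 1 :: real"
    have "quantile_loss \<alpha> a - quantile_loss \<alpha> b \<le> ?s * (a - b)"
      using quantile_loss_subgradient[OF assms, of a b] by (simp add: algebra_simps)
    also have "\<dots> \<le> \<bar>?s\<bar> * \<bar>a - b\<bar>"
      by (metis abs_ge_self abs_mult)
    also have "\<dots> \<le> (\<alpha> / (1 - \<alpha>) + 1) * \<bar>a - b\<bar>"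
      using k by (intro mult_right_mono) (simp_all del: abs_divide)
    finally show ?thesis .
  qed
  from this[of x u] this[of u x] show ?thesis
    by (simp add: abs_minus_commute abs_le_iff)
qed

text \<open>On each half-line the loss is |x| times its absolute slope there, and the smaller of the
  two is positive for \<alpha> in (0,1). This transfers growth of the mean absolute residual to the
  expected loss.\<close>

lemma quantile_loss_coercive:
  assumes "0 < \<alpha>" "\<alpha> < 1"
  shows "min (\<alpha> / (1 - \<alpha>)) 1 * \<bar>x\<bar> \<le> quantile_loss \<alpha> x"
proof (cases "0 \<le> x")
  case True
  then have "min (\<alpha> / (1 - \<alpha>)) 1 * x \<le> \<alpha> / (1 - \<alpha>) * x"
    by (intro mult_right_mono) auto
  with True show ?thesis by (simp add: quantile_loss_def)
next
  case False
  then have "min (\<alpha> / (1 - \<alpha>)) 1 * (- x) \<le> 1 * (- x)"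
    by (intro mult_right_mono) auto
  with False show ?thesis by (simp add: quantile_loss_def)
qed

lemma quantile_loss_scale:
  assumes "0 \<le> c"
  shows "quantile_loss \<alpha> (c * x) = c * quantile_loss \<alpha> x"
proof -
  have "max (c * x) 0 = c * max x 0" "max (- (c * x)) 0 = c * max (- x) 0"
    using assms by (auto simp: max_mult_distrib_left)
  then show ?thesis
    unfolding quantile_loss_def by (simp add: algebra_simps)
qed

lemma quantile_loss_measurable [measurable]: "quantile_loss \<alpha> \<in> borel_measurable borel"
  unfolding quantile_loss_def by measurable

lemma quantile_loss_integrable:
  "integrable M X \<Longrightarrow> integrable M (\<lambda>\<omega>. quantile_loss \<alpha> (X \<omega>))"
  unfolding quantile_loss_def by auto

section \<open>Square-integrable random variables\<close>

lemma square_integrable_mult: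
  assumes "X \<in> square_integrable M" "Z \<in> square_integrable M"
  shows "integrable M (\<lambda>\<omega>. X \<omega> * Z \<omega>)"
proof (rule Bochner_Integration.integrable_bound)
  have [measurable]: "X \<in> borel_measurable M" "Z \<in> borel_measurable M"
    using assms by (auto simp: square_integrable_def)
  show "integrable M (\<lambda>\<omega>. (X \<omega>)\<^sup>2 + (Z \<omega>)\<^sup>2)"
    using assms by (auto simp: square_integrable_def)
  show "(\<lambda>\<omega>. X \<omega> * Z \<omega>) \<in> borel_measurable M"
    by measurable
  have "\<bar>x * z\<bar> \<le> x\<^sup>2 + z\<^sup>2" for x z :: real
    using sum_squares_bound[of "\<bar>x\<bar>" "\<bar>z\<bar>"] abs_ge_zero[of "x * z"]
    unfolding abs_mult power2_abs by linarith
  then show "AE \<omega> in M. norm (X \<omega> * Z \<omega>) \<le> norm ((X \<omega>)\<^sup>2 + (Z \<omega>)\<^sup>2)"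
    by simp
qed

lemma square_integrable_add:
  assumes "X \<in> square_integrable M" "Z \<in> square_integrable M"
  shows "(\<lambda>\<omega>. X \<omega> + Z \<omega>) \<in> square_integrable M"
proof -
  have "integrable M (\<lambda>\<omega>. (X \<omega>)\<^sup>2 + (Z \<omega>)\<^sup>2 + 2 * (X \<omega> * Z \<omega>))"
    using assms square_integrable_mult[OF assms] by (auto simp: square_integrable_def)
  then show ?thesis
    using assms by (auto simp: square_integrable_def power2_sum mult.assoc)
qed

lemma square_integrable_scale:
  assumes "X \<in> square_integrable M"
  shows "(\<lambda>\<omega>. c * X \<omega>) \<in> square_integrable M"
  using assms by (auto simp: square_integrable_def power_mult_distrib)

lemma square_integrable_diff:
  assumes "X \<in> square_integrable M" "Z \<in> square_integrable M"
  shows "(\<lambda>\<omega>. X \<omega> - Z \<omega>) \<in> square_integrable M"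
  using square_integrable_add[OF assms(1) square_integrable_scale[OF assms(2), of "- 1"]] by simp

text \<open>A hedgeable payoff is only known to be measurable and almost surely equal to a portfolio
  value; this is how it inherits square integrability.\<close>

lemma square_integrable_cong_AE:
  assumes "X \<in> square_integrable M" "Z \<in> borel_measurable M" "AE \<omega> in M. Z \<omega> = X \<omega>"
  shows "Z \<in> square_integrable M"
proof -
  have [measurable]: "X \<in> borel_measurable M" "Z \<in> borel_measurable M"
    using assms by (auto simp: square_integrable_def)
  have "integrable M (\<lambda>\<omega>. (Z \<omega>)\<^sup>2) \<longleftrightarrow> integrable M (\<lambda>\<omega>. (X \<omega>)\<^sup>2)"
    using assms(3) by (intro integrable_cong_AE) auto
  then show ?thesis
    using assms by (simp add: square_integrable_def)
qed

lemma (in prob_space) square_integrable_integrable: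
  assumes "X \<in> square_integrable M"
  shows "integrable M X"
  using square_integrable_mult[OF assms, of "\<lambda>_. 1"] by (simp add: square_integrable_def)

section \<open>Products of independent random variables\<close>

text \<open>\<open>X\<close> and \<open>Z\<close> may have different types, but \<open>f\<close> and
  \<open>g\<close> make both real-valued, so the product rule for \<open>indep_var\<close> applies
  after composition.\<close>

lemma (in prob_space) indep_set_expectation_mult:
  fixes X :: "'a \<Rightarrow> 'b::topological_space" and Z :: "'a \<Rightarrow> 'c::topological_space"
    and f :: "'b \<Rightarrow> real" and g :: "'c \<Rightarrow> real"
  assumes indep: "indep_set {X -` A \<inter> space M | A. A \<in> sets borel} {Z -` B \<inter> space M | B. B \<in> sets borel}"
    and [measurable]: "X \<in> borel_measurable M" "Z \<in> borel_measurable M"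
      "f \<in> borel_measurable borel" "g \<in> borel_measurable borel"
    and int: "integrable M (\<lambda>\<omega>. f (X \<omega>))" "integrable M (\<lambda>\<omega>. g (Z \<omega>))"
  shows "integrable M (\<lambda>\<omega>. f (X \<omega>) * g (Z \<omega>))"
    and "expectation (\<lambda>\<omega>. f (X \<omega>) * g (Z \<omega>)) =
      expectation (\<lambda>\<omega>. f (X \<omega>)) * expectation (\<lambda>\<omega>. g (Z \<omega>))"
proof -
  \<comment> \<open>Events determined by a function of \<open>W\<close> are events determined by
    \<open>W\<close>, so independence passes to the smaller families.\<close>
  have sub: "\<exists>A'. (\<lambda>\<omega>. h (W \<omega>)) -` A \<inter> space M = W -` A' \<inter> space M \<and> A' \<in> sets borel"
    if "h \<in> borel_measurable borel" "A \<in> sets borel"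
    for h :: "'d::topological_space \<Rightarrow> real" and W :: "'a \<Rightarrow> 'd" and A
    using measurable_sets[OF that] by (intro exI[of _ "h -` A"]) auto
  have "indep_set {(\<lambda>\<omega>. f (X \<omega>)) -` A \<inter> space M | A. A \<in> sets borel}
      {(\<lambda>\<omega>. g (Z \<omega>)) -` B \<inter> space M | B. B \<in> sets borel}"
    using indep unfolding indep_set_def
  proof (rule indep_sets_mono_sets)
    fix b
    show "(case b of True \<Rightarrow> {(\<lambda>\<omega>. f (X \<omega>)) -` A \<inter> space M | A. A \<in> sets borel}
        | False \<Rightarrow> {(\<lambda>\<omega>. g (Z \<omega>)) -` B \<inter> space M | B. B \<in> sets borel})
      \<subseteq> (case b of True \<Rightarrow> {X -` A \<inter> space M | A. A \<in> sets borel}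
        | False \<Rightarrow> {Z -` B \<inter> space M | B. B \<in> sets borel})"
      using sub[of f _ X] sub[of g _ Z] by (cases b) auto
  qed
  \<comment> \<open>Independence of two families extends to the sigma-algebras they generate when
    the families are closed under intersection.\<close>
  moreover have stable: "Int_stable {h -` A \<inter> space M | A. A \<in> sets borel}" for h :: "'a \<Rightarrow> real"
  proof (rule Int_stableI, clarify)
    fix A B :: "real set"
    assume "A \<in> sets borel" "B \<in> sets borel"
    then show "\<exists>A'. h -` A \<inter> space M \<inter> (h -` B \<inter> space M) = h -` A' \<inter> space M \<and> A' \<in> sets borel"
      by (intro exI[of _ "A \<inter> B"]) auto
  qed
  ultimately have "indep_set (sigma_sets (space M) {(\<lambda>\<omega>. f (X \<omega>)) -` A \<inter> space M | A. A \<in> sets borel})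
      (sigma_sets (space M) {(\<lambda>\<omega>. g (Z \<omega>)) -` B \<inter> space M | B. B \<in> sets borel})"
    by (intro indep_set_sigma_sets stable)
  then have "indep_var borel (\<lambda>\<omega>. f (X \<omega>)) borel (\<lambda>\<omega>. g (Z \<omega>))"
    by (simp add: indep_var_eq)
  then show "integrable M (\<lambda>\<omega>. f (X \<omega>) * g (Z \<omega>))"
    and "expectation (\<lambda>\<omega>. f (X \<omega>) * g (Z \<omega>)) =
      expectation (\<lambda>\<omega>. f (X \<omega>)) * expectation (\<lambda>\<omega>. g (Z \<omega>))"
    using int by (auto intro: indep_var_integrable indep_var_lebesgue_integral)
qed

section \<open>Least squares for a non-redundant random vector\<close>

text \<open>The two minimisation problems only see a square-integrable vector whose coordinates are
  almost surely linearly independent, so they are treated in an arbitrary Euclidean space; the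
  market is an instance.\<close>

locale non_redundant_payoff = prob_space M for M :: "'a measure" +
  fixes Y :: "'a \<Rightarrow> 'e::euclidean_space"
  assumes payoff_measurable [measurable]: "Y \<in> borel_measurable M"
    and norm_payoff_square_integrable: "(\<lambda>\<omega>. norm (Y \<omega>)) \<in> square_integrable M"
    and inner_payoff_AE_zero: "(AE \<omega> in M. \<beta> \<bullet> Y \<omega> = 0) \<Longrightarrow> \<beta> = 0"
begin

lemma scaleR_payoff_integrable:
  assumes "X \<in> square_integrable M"
  shows "integrable M (\<lambda>\<omega>. X \<omega> *\<^sub>R Y \<omega>)"
proof (rule Bochner_Integration.integrable_bound)
  show "integrable M (\<lambda>\<omega>. X \<omega> * norm (Y \<omega>))"
    by (rule square_integrable_mult[OF assms norm_payoff_square_integrable])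
  have [measurable]: "X \<in> borel_measurable M"
    using assms by (simp add: square_integrable_def)
  show "(\<lambda>\<omega>. X \<omega> *\<^sub>R Y \<omega>) \<in> borel_measurable M"
    by measurable
qed simp

lemma inner_payoff_square_integrable: "(\<lambda>\<omega>. \<beta> \<bullet> Y \<omega>) \<in> square_integrable M"
proof -
  have "integrable M (\<lambda>\<omega>. (\<beta> \<bullet> Y \<omega>)\<^sup>2)"
  proof (rule Bochner_Integration.integrable_bound)
    show "integrable M (\<lambda>\<omega>. (norm \<beta>)\<^sup>2 * (norm (Y \<omega>))\<^sup>2)"
      using norm_payoff_square_integrable by (simp add: square_integrable_def)
    have "(\<beta> \<bullet> Y \<omega>)\<^sup>2 \<le> (norm \<beta>)\<^sup>2 * (norm (Y \<omega>))\<^sup>2" for \<omega>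
      using Cauchy_Schwarz_ineq2[of \<beta> "Y \<omega>"]
      by (metis abs_ge_zero power2_abs power_mono power_mult_distrib)
    then show "AE \<omega> in M. norm ((\<beta> \<bullet> Y \<omega>)\<^sup>2) \<le> norm ((norm \<beta>)\<^sup>2 * (norm (Y \<omega>))\<^sup>2)"
      by simp
  qed measurable
  then show ?thesis
    by (simp add: square_integrable_def)
qed

lemma inner_payoff_integrable: "integrable M (\<lambda>\<omega>. \<beta> \<bullet> Y \<omega>)"
  using inner_payoff_square_integrable by (rule square_integrable_integrable)

lemma norm_payoff_integrable: "integrable M (\<lambda>\<omega>. norm (Y \<omega>))"
  using norm_payoff_square_integrable by (rule square_integrable_integrable)

lemma residual_square_integrable:
  "X \<in> square_integrable M \<Longrightarrow> (\<lambda>\<omega>. X \<omega> - \<beta> \<bullet> Y \<omega>) \<in> square_integrable M"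
  by (intro square_integrable_diff inner_payoff_square_integrable)

lemma inner_payoff_second_moment_eq_0D:
  assumes "expectation (\<lambda>\<omega>. (\<beta> \<bullet> Y \<omega>)\<^sup>2) = 0"
  shows "\<beta> = 0"
proof -
  have "AE \<omega> in M. (\<beta> \<bullet> Y \<omega>)\<^sup>2 = 0"
    using assms inner_payoff_square_integrable[of \<beta>]
    by (subst integral_nonneg_eq_0_iff_AE[symmetric]) (auto simp: square_integrable_def)
  then show ?thesis
    by (intro inner_payoff_AE_zero) simp
qed

text \<open>The Gram operator \<open>G\<close> satisfies \<beta> \<bullet> G \<beta> =
  E[(\<beta> \<bullet> Y)^2], which vanishes only at 0. Hence \<open>G\<close> is injective, and in
  finite dimension surjective; a preimage of E[X Y] solves the equations.\<close>

lemma normal_equations_solvable: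
  assumes X: "X \<in> square_integrable M"
  obtains \<theta> where "\<And>\<beta>. expectation (\<lambda>\<omega>. (X \<omega> - \<theta> \<bullet> Y \<omega>) * (\<beta> \<bullet> Y \<omega>)) = 0"
proof -
  define G where "G \<beta> = (\<integral>\<omega>. (\<beta> \<bullet> Y \<omega>) *\<^sub>R Y \<omega> \<partial>M)" for \<beta>
  have moment: "\<gamma> \<bullet> (\<integral>\<omega>. Z \<omega> *\<^sub>R Y \<omega> \<partial>M) = expectation (\<lambda>\<omega>. Z \<omega> * (\<gamma> \<bullet> Y \<omega>))"
    if "Z \<in> square_integrable M" for Z \<gamma>
    using integral_inner_right[OF scaleR_payoff_integrable[OF that], of \<gamma>] by simp
  note int = scaleR_payoff_integrable[OF inner_payoff_square_integrable]
  have "linear G"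
  proof (rule linearI)
    show "G (\<beta> + \<gamma>) = G \<beta> + G \<gamma>" for \<beta> \<gamma>
      unfolding G_def using int
      by (simp add: inner_add_left scaleR_left.add Bochner_Integration.integral_add)
    show "G (c *\<^sub>R \<beta>) = c *\<^sub>R G \<beta>" for c \<beta>
      unfolding G_def by (simp flip: scaleR_scaleR)
  qed
  moreover have "inj G"
  proof (rule linear_injective_0[OF \<open>linear G\<close>, THEN iffD2, rule_format])
    fix \<beta> assume "G \<beta> = 0"
    then have "\<beta> \<bullet> G \<beta> = 0" by simp
    then have "expectation (\<lambda>\<omega>. (\<beta> \<bullet> Y \<omega>)\<^sup>2) = 0"
      unfolding G_def moment[OF inner_payoff_square_integrable] by (simp add: power2_eq_square)
    then show "\<beta> = 0" by (rule inner_payoff_second_moment_eq_0D)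
  qed
  ultimately have "surj G"
    by (simp add: linear_injective_imp_surjective)
  then obtain \<theta> where \<theta>: "G \<theta> = (\<integral>\<omega>. X \<omega> *\<^sub>R Y \<omega> \<partial>M)"
    by (metis surjD)
  have "expectation (\<lambda>\<omega>. (X \<omega> - \<theta> \<bullet> Y \<omega>) * (\<beta> \<bullet> Y \<omega>)) = 0" for \<beta>
  proof -
    have "expectation (\<lambda>\<omega>. (X \<omega> - \<theta> \<bullet> Y \<omega>) * (\<beta> \<bullet> Y \<omega>)) =
        expectation (\<lambda>\<omega>. X \<omega> * (\<beta> \<bullet> Y \<omega>)) - expectation (\<lambda>\<omega>. (\<theta> \<bullet> Y \<omega>) * (\<beta> \<bullet> Y \<omega>))"
      unfolding left_diff_distrib
      by (intro Bochner_Integration.integral_diff square_integrable_mult X inner_payoff_square_integrable)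
    also have "\<dots> = \<beta> \<bullet> (\<integral>\<omega>. X \<omega> *\<^sub>R Y \<omega> \<partial>M) - \<beta> \<bullet> G \<theta>"
      unfolding G_def using moment[OF X] moment[OF inner_payoff_square_integrable] by simp
    finally show ?thesis using \<theta> by simp
  qed
  with that show thesis by blast
qed

text \<open>Pythagoras: the residual of \<theta> is orthogonal to all portfolio values, so the cross
  term disappears.\<close>

lemma squared_error_decomposition:
  assumes X: "X \<in> square_integrable M"
    and orth: "\<And>\<beta>. expectation (\<lambda>\<omega>. (X \<omega> - \<theta> \<bullet> Y \<omega>) * (\<beta> \<bullet> Y \<omega>)) = 0"
  shows "expectation (\<lambda>\<omega>. (X \<omega> - \<beta> \<bullet> Y \<omega>)\<^sup>2) =
    expectation (\<lambda>\<omega>. (X \<omega> - \<theta> \<bullet> Y \<omega>)\<^sup>2) + expectation (\<lambda>\<omega>. ((\<theta> - \<beta>) \<bullet> Y \<omega>)\<^sup>2)"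
proof -
  have "(X \<omega> - \<beta> \<bullet> Y \<omega>)\<^sup>2 = (X \<omega> - \<theta> \<bullet> Y \<omega>)\<^sup>2 + ((\<theta> - \<beta>) \<bullet> Y \<omega>)\<^sup>2
      + 2 * ((X \<omega> - \<theta> \<bullet> Y \<omega>) * ((\<theta> - \<beta>) \<bullet> Y \<omega>))" for \<omega>
    by (simp add: inner_diff_left power2_eq_square algebra_simps)
  moreover have "integrable M (\<lambda>\<omega>. (X \<omega> - \<theta> \<bullet> Y \<omega>)\<^sup>2)" "integrable M (\<lambda>\<omega>. ((\<theta> - \<beta>) \<bullet> Y \<omega>)\<^sup>2)"
    "integrable M (\<lambda>\<omega>. (X \<omega> - \<theta> \<bullet> Y \<omega>) * ((\<theta> - \<beta>) \<bullet> Y \<omega>))"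
    using residual_square_integrable[OF X, of \<theta>] inner_payoff_square_integrable[of "\<theta> - \<beta>"]
    by (auto simp: square_integrable_def intro!: square_integrable_mult)
  ultimately show ?thesis
    by (simp add: orth)
qed

text \<open>By the decomposition the excess error of \<beta> over \<theta> is the second moment of
  (\<theta> - \<beta>) \<bullet> Y. It is nonnegative and zero only for \<beta> = \<theta>; this
  uniqueness pins down the choice made by \<open>arg_min\<close>.\<close>

lemma arg_min_squared_error:
  assumes X: "X \<in> square_integrable M"
    and orth: "\<And>\<beta>. expectation (\<lambda>\<omega>. (X \<omega> - \<theta> \<bullet> Y \<omega>) * (\<beta> \<bullet> Y \<omega>)) = 0"
  shows "arg_min (\<lambda>\<beta>. expectation (\<lambda>\<omega>. (X \<omega> - \<beta> \<bullet> Y \<omega>)\<^sup>2)) (\<lambda>_. True) = \<theta>"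
proof (rule arg_minI)
  note decomp = squared_error_decomposition[OF assms]
  show "\<not> expectation (\<lambda>\<omega>. (X \<omega> - \<beta> \<bullet> Y \<omega>)\<^sup>2) < expectation (\<lambda>\<omega>. (X \<omega> - \<theta> \<bullet> Y \<omega>)\<^sup>2)" for \<beta>
    unfolding decomp[of \<beta>] by (simp add: not_less)
  fix \<beta>
  assume "\<forall>\<gamma>. True \<longrightarrow> \<not> expectation (\<lambda>\<omega>. (X \<omega> - \<gamma> \<bullet> Y \<omega>)\<^sup>2) < expectation (\<lambda>\<omega>. (X \<omega> - \<beta> \<bullet> Y \<omega>)\<^sup>2)"
  then have "expectation (\<lambda>\<omega>. ((\<theta> - \<beta>) \<bullet> Y \<omega>)\<^sup>2) \<le> 0"
    unfolding decomp[of \<beta>] by (auto simp: not_less dest: spec[of _ \<theta>])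
  then have "expectation (\<lambda>\<omega>. ((\<theta> - \<beta>) \<bullet> Y \<omega>)\<^sup>2) = 0"
    by (intro antisym) simp_all
  then show "\<beta> = \<theta>"
    using inner_payoff_second_moment_eq_0D[of "\<theta> - \<beta>"] by simp
qed simp

section \<open>Minimising the expected quantile loss\<close>

text \<open>Non-redundancy makes E|\<beta> \<bullet> Y| a norm on strategies, and norms in finite
  dimension are equivalent: \<open>m\<close> is its minimum over the unit sphere, extended by
  homogeneity.\<close>

lemma inner_payoff_first_moment_lower_bound:
  obtains m where "0 < m" "\<And>\<beta>. m * norm \<beta> \<le> expectation (\<lambda>\<omega>. \<bar>\<beta> \<bullet> Y \<omega>\<bar>)"
proof -
  define N where "N \<beta> = expectation (\<lambda>\<omega>. \<bar>\<beta> \<bullet> Y \<omega>\<bar>)" for \<beta>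
  have int: "integrable M (\<lambda>\<omega>. \<bar>\<beta> \<bullet> Y \<omega>\<bar>)" for \<beta>
    using inner_payoff_integrable by simp
  have le: "N \<beta> - N \<gamma> \<le> expectation (\<lambda>\<omega>. norm (Y \<omega>)) * dist \<beta> \<gamma>" for \<beta> \<gamma>
  proof -
    have "N \<beta> - N \<gamma> = expectation (\<lambda>\<omega>. \<bar>\<beta> \<bullet> Y \<omega>\<bar> - \<bar>\<gamma> \<bullet> Y \<omega>\<bar>)"
      unfolding N_def using int by simp
    also have "\<dots> \<le> expectation (\<lambda>\<omega>. norm (Y \<omega>) * dist \<beta> \<gamma>)"
    proof (rule integral_mono)
      fix \<omega>
      have "\<bar>\<beta> \<bullet> Y \<omega>\<bar> - \<bar>\<gamma> \<bullet> Y \<omega>\<bar> \<le> \<bar>(\<beta> - \<gamma>) \<bullet> Y \<omega>\<bar>"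
        by (simp add: inner_diff_left)
      also have "\<dots> \<le> norm (Y \<omega>) * dist \<beta> \<gamma>"
        using Cauchy_Schwarz_ineq2[of "\<beta> - \<gamma>" "Y \<omega>"] by (simp add: dist_norm mult.commute)
      finally show "\<bar>\<beta> \<bullet> Y \<omega>\<bar> - \<bar>\<gamma> \<bullet> Y \<omega>\<bar> \<le> norm (Y \<omega>) * dist \<beta> \<gamma>" .
    qed (use int norm_payoff_integrable in auto)
    finally show ?thesis by simp
  qed
  have "(expectation (\<lambda>\<omega>. norm (Y \<omega>)))-lipschitz_on UNIV N"
    using le by (intro lipschitz_onI) (auto simp: dist_real_def abs_le_iff, metis dist_commute)
  then have "continuous_on (sphere 0 1) N"
    using lipschitz_on_continuous_on continuous_on_subset by blast
  moreover have "sphere (0::'e) 1 \<noteq> {}"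
    by simp
  ultimately obtain \<gamma> where \<gamma>: "\<gamma> \<in> sphere 0 1" "\<And>\<beta>. \<beta> \<in> sphere 0 1 \<Longrightarrow> N \<gamma> \<le> N \<beta>"
    by (metis compact_sphere continuous_attains_inf)
  \<comment> \<open>A zero minimum would be a unit vector with almost surely zero payoff.\<close>
  have "N \<gamma> \<noteq> 0"
  proof
    assume "N \<gamma> = 0"
    then have "AE \<omega> in M. \<bar>\<gamma> \<bullet> Y \<omega>\<bar> = 0"
      unfolding N_def using int by (subst integral_nonneg_eq_0_iff_AE[symmetric]) auto
    then have "\<gamma> = 0"
      by (intro inner_payoff_AE_zero) simp
    with \<gamma>(1) show False by simp
  qed
  then have "0 < N \<gamma>"
    by (simp add: N_def less_le)
  moreover have "N \<gamma> * norm \<beta> \<le> N \<beta>" for \<beta>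
  proof (cases "\<beta> = 0")
    case False
    have "N \<beta> = expectation (\<lambda>\<omega>. norm \<beta> * \<bar>(\<beta> /\<^sub>R norm \<beta>) \<bullet> Y \<omega>\<bar>)"
      unfolding N_def using False
      by (intro Bochner_Integration.integral_cong) (simp_all add: abs_mult)
    also have "\<dots> = norm \<beta> * N (\<beta> /\<^sub>R norm \<beta>)"
      unfolding N_def by simp
    also have "\<dots> \<ge> norm \<beta> * N \<gamma>"
      using False by (intro mult_left_mono \<gamma>(2)) auto
    finally show ?thesis by (simp add: mult.commute)
  qed (simp add: N_def)
  ultimately show thesis
    using that unfolding N_def by blast
qed

text \<open>The expected loss is continuous and outside a large ball is at least its value at 0, so
  its minimum over the compact ball is global.\<close>

lemma expected_quantile_loss_minimiser_exists:
  assumes \<alpha>: "0 < \<alpha>" "\<alpha> < 1" and X: "integrable M X"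
  shows "\<exists>\<eta>. is_arg_min (\<lambda>\<beta>. expectation (\<lambda>\<omega>. quantile_loss \<alpha> (X \<omega> - \<beta> \<bullet> Y \<omega>))) (\<lambda>_. True) \<eta>"
proof -
  define f where "f \<beta> = expectation (\<lambda>\<omega>. quantile_loss \<alpha> (X \<omega> - \<beta> \<bullet> Y \<omega>))" for \<beta>
  define L where "L = \<alpha> / (1 - \<alpha>) + 1"
  define c where "c = min (\<alpha> / (1 - \<alpha>)) 1"
  have "0 < L" "0 < c"
    using \<alpha> by (auto simp: L_def c_def intro: add_pos_pos)
  have int: "integrable M (\<lambda>\<omega>. quantile_loss \<alpha> (X \<omega> - \<beta> \<bullet> Y \<omega>))" for \<beta>
    using X inner_payoff_integrable by (intro quantile_loss_integrable) auto
  have le: "f \<beta> - f \<gamma> \<le> L * expectation (\<lambda>\<omega>. norm (Y \<omega>)) * dist \<beta> \<gamma>" for \<beta> \<gamma>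
  proof -
    have "f \<beta> - f \<gamma> = expectation (\<lambda>\<omega>. quantile_loss \<alpha> (X \<omega> - \<beta> \<bullet> Y \<omega>) - quantile_loss \<alpha> (X \<omega> - \<gamma> \<bullet> Y \<omega>))"
      unfolding f_def using int by simp
    also have "\<dots> \<le> expectation (\<lambda>\<omega>. L * (norm (Y \<omega>) * dist \<beta> \<gamma>))"
    proof (rule integral_mono)
      fix \<omega>
      have "quantile_loss \<alpha> (X \<omega> - \<beta> \<bullet> Y \<omega>) - quantile_loss \<alpha> (X \<omega> - \<gamma> \<bullet> Y \<omega>) \<le> L * \<bar>(\<gamma> - \<beta>) \<bullet> Y \<omega>\<bar>"
        using quantile_loss_lipschitz[OF \<alpha>, of "X \<omega> - \<beta> \<bullet> Y \<omega>" "X \<omega> - \<gamma> \<bullet> Y \<omega>"]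
        by (simp add: L_def inner_diff_left)
      also have "\<dots> \<le> L * (norm (Y \<omega>) * dist \<beta> \<gamma>)"
        using Cauchy_Schwarz_ineq2[of "\<gamma> - \<beta>" "Y \<omega>"] \<open>0 < L\<close>
        by (simp add: dist_norm mult.commute norm_minus_commute)
      finally show "quantile_loss \<alpha> (X \<omega> - \<beta> \<bullet> Y \<omega>) - quantile_loss \<alpha> (X \<omega> - \<gamma> \<bullet> Y \<omega>)
        \<le> L * (norm (Y \<omega>) * dist \<beta> \<gamma>)" .
    qed (use int norm_payoff_integrable in auto)
    finally show ?thesis by (simp add: mult.assoc)
  qed
  have "(L * expectation (\<lambda>\<omega>. norm (Y \<omega>)))-lipschitz_on UNIV f"
    using le \<open>0 < L\<close> by (intro lipschitz_onI) (auto simp: dist_real_def abs_le_iff, metis dist_commute)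
  then have cont: "continuous_on A f" for A
    using lipschitz_on_continuous_on continuous_on_subset by blast
  obtain m where m: "0 < m" "\<And>\<beta>. m * norm \<beta> \<le> expectation (\<lambda>\<omega>. \<bar>\<beta> \<bullet> Y \<omega>\<bar>)"
    using inner_payoff_first_moment_lower_bound by blast
  define E where "E = expectation (\<lambda>\<omega>. \<bar>X \<omega>\<bar>)"
  \<comment> \<open>The triangle inequality bounds the mean absolute residual below by E|\<beta>
    \<bullet> Y| - E|X|.\<close>
  have coercive: "c * (m * norm \<beta> - E) \<le> f \<beta>" for \<beta>
  proof -
    have "m * norm \<beta> - E \<le> expectation (\<lambda>\<omega>. \<bar>\<beta> \<bullet> Y \<omega>\<bar>) - E"
      using m(2) by simp
    also have "\<dots> = expectation (\<lambda>\<omega>. \<bar>\<beta> \<bullet> Y \<omega>\<bar> - \<bar>X \<omega>\<bar>)"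
      unfolding E_def using X inner_payoff_integrable by simp
    also have "\<dots> \<le> expectation (\<lambda>\<omega>. \<bar>X \<omega> - \<beta> \<bullet> Y \<omega>\<bar>)"
      using X inner_payoff_integrable by (intro integral_mono) auto
    finally have "c * (m * norm \<beta> - E) \<le> expectation (\<lambda>\<omega>. c * \<bar>X \<omega> - \<beta> \<bullet> Y \<omega>\<bar>)"
      using \<open>0 < c\<close> by simp
    also have "\<dots> \<le> f \<beta>"
      unfolding f_def c_def
      using X inner_payoff_integrable int
      by (intro integral_mono quantile_loss_coercive[OF \<alpha>]) auto
    finally show ?thesis .
  qed
  \<comment> \<open>The quotient solves c * (m * t - E) = f 0 for t, so beyond this radius the lower
    bound is at least \<open>f 0\<close>. The absolute value keeps the radius nonnegative, so that 0
    lies in the ball.\<close>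
  define K where "K = \<bar>(f 0 / c + E) / m\<bar>"
  have "0 \<le> K"
    unfolding K_def by (rule abs_ge_zero)
  then have "cball (0::'e) K \<noteq> {}"
    by simp
  then obtain \<eta> where \<eta>: "\<And>\<beta>. \<beta> \<in> cball 0 K \<Longrightarrow> f \<eta> \<le> f \<beta>"
    by (metis compact_cball cont continuous_attains_inf)
  have "f \<eta> \<le> f \<beta>" for \<beta>
  proof (cases "\<beta> \<in> cball 0 K")
    case False
    then have "(f 0 / c + E) / m \<le> norm \<beta>"
      using abs_ge_self[of "(f 0 / c + E) / m"] by (simp add: K_def del: abs_divide)
    then have "f 0 \<le> c * (m * norm \<beta> - E)"
      using \<open>0 < m\<close> \<open>0 < c\<close> by (simp add: field_simps)
    moreover have "f \<eta> \<le> f 0"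
      using \<open>0 \<le> K\<close> by (intro \<eta>) simp
    ultimately show ?thesis
      using coercive[of \<beta>] by linarith
  qed (rule \<eta>)
  then show ?thesis
    unfolding is_arg_min_def f_def by (auto simp: not_less)
qed

text \<open>The expected loss is at least a positive multiple of the norm of \<beta> and vanishes at
  0. This covers the zero claim, which may lie outside \<open>C\<close> and hence outside the
  uniqueness condition.\<close>

lemma is_arg_min_quantile_loss_zero:
  assumes \<alpha>: "0 < \<alpha>" "\<alpha> < 1"
    and \<beta>: "is_arg_min (\<lambda>\<beta>. expectation (\<lambda>\<omega>. quantile_loss \<alpha> (- (\<beta> \<bullet> Y \<omega>)))) (\<lambda>_. True) \<beta>"
  shows "\<beta> = 0"
proof -
  obtain m where m: "0 < m" "\<And>\<beta>. m * norm \<beta> \<le> expectation (\<lambda>\<omega>. \<bar>\<beta> \<bullet> Y \<omega>\<bar>)"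
    using inner_payoff_first_moment_lower_bound by blast
  define c where "c = min (\<alpha> / (1 - \<alpha>)) 1"
  have "0 < c"
    using \<alpha> by (simp add: c_def)
  have int: "integrable M (\<lambda>\<omega>. quantile_loss \<alpha> (- (\<beta> \<bullet> Y \<omega>)))"
    using inner_payoff_integrable by (intro quantile_loss_integrable) auto
  have "c * (m * norm \<beta>) \<le> expectation (\<lambda>\<omega>. c * \<bar>- (\<beta> \<bullet> Y \<omega>)\<bar>)"
    using m \<open>0 < c\<close> by simp
  also have "\<dots> \<le> expectation (\<lambda>\<omega>. quantile_loss \<alpha> (- (\<beta> \<bullet> Y \<omega>)))"
    unfolding c_def using inner_payoff_integrable int
    by (intro integral_mono quantile_loss_coercive[OF \<alpha>]) auto
  also have "\<dots> \<le> expectation (\<lambda>\<omega>. quantile_loss \<alpha> (- ((0::'e) \<bullet> Y \<omega>)))"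
    using \<beta> unfolding is_arg_min_def by (metis not_less)
  also have "\<dots> = 0"
    by (simp add: quantile_loss_def)
  finally show ?thesis
    using \<open>0 < m\<close> \<open>0 < c\<close> by (simp add: mult_le_0_iff)
qed

end

section \<open>Hedging strategies in the market\<close>

context market
begin

abbreviation "Y \<equiv> asset_values r R"

lemma risky_asset_square_integrable: "R k \<in> square_integrable M"
  using claims risky_assets by blast

lemma asset_values_measurable: "Y \<in> borel_measurable M"
proof -
  have [measurable]: "R k \<in> borel_measurable M" for k
    using risky_asset_square_integrable by (auto simp: square_integrable_def)
  have "(\<lambda>\<omega>. \<chi> k. R k \<omega>) \<in> borel_measurable M"
    by (subst borel_measurable_euclidean_space) (auto simp: Basis_vec_def inner_axis)
  then have "(\<lambda>\<omega>. (exp r, \<chi> k. R k \<omega>)) \<in> borel_measurable M"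
    by (intro borel_measurable_Pair) auto
  then show ?thesis
    by (simp add: asset_values_def[abs_def])
qed

sublocale non_redundant_payoff M "asset_values r R"
proof
  show "Y \<in> borel_measurable M"
    by (rule asset_values_measurable)
  then have [measurable]: "Y \<in> borel_measurable M" .
  have "(norm (Y \<omega>))\<^sup>2 = (exp r)\<^sup>2 + (\<Sum>k\<in>UNIV. (R k \<omega>)\<^sup>2)" for \<omega>
    by (simp add: asset_values_def norm_Pair norm_vec_def L2_set_def sum_nonneg)
  then have "integrable M (\<lambda>\<omega>. (norm (Y \<omega>))\<^sup>2)"
    using risky_asset_square_integrable by (auto simp: square_integrable_def)
  then show "(\<lambda>\<omega>. norm (Y \<omega>)) \<in> square_integrable M"
    by (simp add: square_integrable_def)
  show "\<beta> = 0" if "AE \<omega> in M. \<beta> \<bullet> Y \<omega> = 0" for \<beta>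
    using that non_redundant by blast
qed

text \<open>With \<open>quadratic_hedge_orthogonal\<close> this characterises the hedge by the
  normal equations, so later proofs never return to the squared error.\<close>

lemma quadratic_hedge_eqI:
  assumes "S \<in> square_integrable M"
    and "\<And>\<beta>. expectation (\<lambda>\<omega>. (S \<omega> - \<theta> \<bullet> Y \<omega>) * (\<beta> \<bullet> Y \<omega>)) = 0"
  shows "quadratic_hedge M Y S = \<theta>"
  unfolding quadratic_hedge_def using assms by (rule arg_min_squared_error)

lemma quadratic_hedge_orthogonal:
  assumes "S \<in> square_integrable M"
  shows "expectation (\<lambda>\<omega>. (S \<omega> - quadratic_hedge M Y S \<bullet> Y \<omega>) * (\<beta> \<bullet> Y \<omega>)) = 0"
  using normal_equations_solvable[OF assms] quadratic_hedge_eqI[OF assms] by metis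

text \<open>Adding \<beta> to the strategy cancels \<open>H\<close> almost surely: the residual is
  the old one and still satisfies the normal equations.\<close>

lemma quadratic_hedge_add_hedgeable:
  assumes S: "S \<in> square_integrable M" and H: "hedged_by M Y H \<beta>"
  shows "quadratic_hedge M Y (\<lambda>\<omega>. S \<omega> + H \<omega>) = quadratic_hedge M Y S + \<beta>"
proof (rule quadratic_hedge_eqI)
  have [measurable]: "H \<in> borel_measurable M" "S \<in> borel_measurable M"
    using H S by (auto simp: hedged_by_def square_integrable_def)
  have AE: "AE \<omega> in M. H \<omega> = \<beta> \<bullet> Y \<omega>"
    using H by (simp add: hedged_by_def)
  have "H \<in> square_integrable M"
    by (rule square_integrable_cong_AE[OF inner_payoff_square_integrable _ AE]) measurable
  with S show "(\<lambda>\<omega>. S \<omega> + H \<omega>) \<in> square_integrable M"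
    by (rule square_integrable_add)
  fix \<gamma>
  have "expectation (\<lambda>\<omega>. (S \<omega> + H \<omega> - (quadratic_hedge M Y S + \<beta>) \<bullet> Y \<omega>) * (\<gamma> \<bullet> Y \<omega>)) =
      expectation (\<lambda>\<omega>. (S \<omega> - quadratic_hedge M Y S \<bullet> Y \<omega>) * (\<gamma> \<bullet> Y \<omega>))"
    using AE by (intro integral_cong_AE) (auto simp: inner_add_left)
  then show "expectation (\<lambda>\<omega>. (S \<omega> + H \<omega> - (quadratic_hedge M Y S + \<beta>) \<bullet> Y \<omega>) * (\<gamma> \<bullet> Y \<omega>)) = 0"
    using quadratic_hedge_orthogonal[OF S] by simp
qed

text \<open>The residual risks agree almost surely, so both claims have the same objective function,
  and \<open>arg_min\<close> picks the same strategy even among several minimisers.\<close>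

lemma quantile_hedge_add_hedgeable:
  assumes S: "S \<in> square_integrable M" and H: "hedged_by M Y H \<beta>"
  shows "quantile_hedge M Y \<alpha> (\<lambda>\<omega>. S \<omega> + H \<omega>) = quantile_hedge M Y \<alpha> S"
proof -
  have [measurable]: "H \<in> borel_measurable M" "S \<in> borel_measurable M"
    using H S by (auto simp: hedged_by_def square_integrable_def)
  have "AE \<omega> in M. H \<omega> = \<beta> \<bullet> Y \<omega>"
    using H by (simp add: hedged_by_def)
  then have "expected_residual_loss M Y \<alpha> (\<lambda>\<omega>. S \<omega> + H \<omega>) \<gamma> = expected_residual_loss M Y \<alpha> S \<gamma>" for \<gamma>
    unfolding expected_residual_loss_def quadratic_hedge_add_hedgeable[OF assms]
    by (intro integral_cong_AE) (auto simp: inner_add_left)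
  then show ?thesis
    unfolding quantile_hedge_def by presburger
qed

lemma mean_quantile_valuation_add_hedgeable:
  assumes "S \<in> square_integrable M" "hedged_by M Y H \<beta>"
  shows "mean_quantile_valuation M Y \<alpha> i y (\<lambda>\<omega>. S \<omega> + H \<omega>) =
    mean_quantile_valuation M Y \<alpha> i y S + \<beta> \<bullet> y"
  unfolding mean_quantile_valuation_def quadratic_hedge_add_hedgeable[OF assms]
    quantile_hedge_add_hedgeable[OF assms]
  by (simp add: inner_add_left)

section \<open>Scaling of claims\<close>

lemma quadratic_hedge_scale:
  assumes S: "S \<in> square_integrable M"
  shows "quadratic_hedge M Y (\<lambda>\<omega>. c * S \<omega>) = c *\<^sub>R quadratic_hedge M Y S"
proof (rule quadratic_hedge_eqI)
  show "(\<lambda>\<omega>. c * S \<omega>) \<in> square_integrable M"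
    using S by (rule square_integrable_scale)
  have "(c * S \<omega> - (c *\<^sub>R quadratic_hedge M Y S) \<bullet> Y \<omega>) * (\<gamma> \<bullet> Y \<omega>) =
      c * ((S \<omega> - quadratic_hedge M Y S \<bullet> Y \<omega>) * (\<gamma> \<bullet> Y \<omega>))" for \<omega> \<gamma>
    by (simp add: algebra_simps)
  then show "expectation (\<lambda>\<omega>. (c * S \<omega> - (c *\<^sub>R quadratic_hedge M Y S) \<bullet> Y \<omega>) * (\<gamma> \<bullet> Y \<omega>)) = 0" for \<gamma>
    using quadratic_hedge_orthogonal[OF S, of \<gamma>] by (simp only: integral_mult_right_zero mult_zero_right)
qed

lemma expected_residual_loss_scale:
  assumes S: "S \<in> square_integrable M" and "0 \<le> c"
  shows "expected_residual_loss M Y \<alpha> (\<lambda>\<omega>. c * S \<omega>) (c *\<^sub>R \<beta>) = c * expected_residual_loss M Y \<alpha> S \<beta>"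
proof -
  have "quantile_loss \<alpha> (c * S \<omega> - (c *\<^sub>R quadratic_hedge M Y S) \<bullet> Y \<omega> - (c *\<^sub>R \<beta>) \<bullet> Y \<omega>) =
      c * quantile_loss \<alpha> (S \<omega> - quadratic_hedge M Y S \<bullet> Y \<omega> - \<beta> \<bullet> Y \<omega>)" for \<omega>
    by (simp add: right_diff_distrib flip: quantile_loss_scale[OF \<open>0 \<le> c\<close>])
  then show ?thesis
    unfolding expected_residual_loss_def quadratic_hedge_scale[OF S] by simp
qed

text \<open>Existence turns the arbitrary choice in \<open>arg_min\<close> into a genuine
  minimiser.\<close>

lemma is_arg_min_quantile_hedge:
  assumes "0 < \<alpha>" "\<alpha> < 1" and S: "S \<in> square_integrable M"
  shows "is_arg_min (expected_residual_loss M Y \<alpha> S) (\<lambda>_. True) (quantile_hedge M Y \<alpha> S)"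
proof -
  have "integrable M (\<lambda>\<omega>. S \<omega> - quadratic_hedge M Y S \<bullet> Y \<omega>)"
    by (intro square_integrable_integrable residual_square_integrable S)
  then have "\<exists>\<eta>. is_arg_min (expected_residual_loss M Y \<alpha> S) (\<lambda>_. True) \<eta>"
    using expected_quantile_loss_minimiser_exists[OF assms(1,2)]
    unfolding expected_residual_loss_def[abs_def] by blast
  then show ?thesis
    unfolding quantile_hedge_def arg_min_def by (rule someI_ex)
qed

text \<open>The scaled claim may lie outside \<open>C\<close>, so uniqueness is only available for
  \<open>S\<close>. Hence a minimiser for the scaled claim is pulled back by division by
  \<open>c\<close>, and the result must be the hedge of \<open>S\<close>.\<close>

lemma quantile_hedge_scale:
  assumes \<alpha>: "0 < \<alpha>" "\<alpha> < 1" and S: "S \<in> square_integrable M" and "0 < c"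
    and unique: "\<exists>\<^sub>\<le>\<^sub>1 \<beta>. is_arg_min (expected_residual_loss M Y \<alpha> S) (\<lambda>_. True) \<beta>"
  shows "quantile_hedge M Y \<alpha> (\<lambda>\<omega>. c * S \<omega>) = c *\<^sub>R quantile_hedge M Y \<alpha> S"
proof -
  let ?\<eta> = "quantile_hedge M Y \<alpha> (\<lambda>\<omega>. c * S \<omega>)"
  have scale: "expected_residual_loss M Y \<alpha> (\<lambda>\<omega>. c * S \<omega>) \<beta> = c * expected_residual_loss M Y \<alpha> S (\<beta> /\<^sub>R c)" for \<beta>
    using expected_residual_loss_scale[OF S, of c \<alpha> "\<beta> /\<^sub>R c"] \<open>0 < c\<close> by simp
  have "expected_residual_loss M Y \<alpha> S (?\<eta> /\<^sub>R c) \<le> expected_residual_loss M Y \<alpha> S \<beta>" for \<beta>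
  proof -
    have "expected_residual_loss M Y \<alpha> (\<lambda>\<omega>. c * S \<omega>) ?\<eta> \<le>
        expected_residual_loss M Y \<alpha> (\<lambda>\<omega>. c * S \<omega>) (c *\<^sub>R \<beta>)"
      using is_arg_min_quantile_hedge[OF \<alpha> square_integrable_scale[OF S, of c]]
      unfolding is_arg_min_def by (metis not_less)
    then show ?thesis
      unfolding scale[of ?\<eta>] scale[of "c *\<^sub>R \<beta>"] using \<open>0 < c\<close> by simp
  qed
  then have "is_arg_min (expected_residual_loss M Y \<alpha> S) (\<lambda>_. True) (?\<eta> /\<^sub>R c)"
    by (auto simp: is_arg_min_def not_less)
  then have "?\<eta> /\<^sub>R c = quantile_hedge M Y \<alpha> S"
    using unique is_arg_min_quantile_hedge[OF \<alpha> S] by (auto dest: Uniq_D)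
  then show ?thesis
    using \<open>0 < c\<close> by (metis divideR_right less_irrefl)
qed

lemma mean_quantile_valuation_zero:
  assumes \<alpha>: "0 < \<alpha>" "\<alpha> < 1"
  shows "mean_quantile_valuation M Y \<alpha> i y (\<lambda>\<omega>. 0) = 0"
proof -
  have S: "(\<lambda>\<omega>. 0) \<in> square_integrable M"
    by (simp add: square_integrable_def)
  have \<theta>: "quadratic_hedge M Y (\<lambda>\<omega>. 0) = 0"
    using quadratic_hedge_scale[OF S, of 0] by simp
  have "quantile_hedge M Y \<alpha> (\<lambda>\<omega>. 0) = 0"
    using is_arg_min_quantile_hedge[OF \<alpha> S]
    by (intro is_arg_min_quantile_loss_zero[OF \<alpha>]) (simp add: expected_residual_loss_def[abs_def] \<theta>)
  with \<theta> show ?thesis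
    by (simp add: mean_quantile_valuation_def)
qed

section \<open>Claims independent of the assets\<close>

lemma risk_free_inner_payoff: "(exp (- r) * a, 0) \<bullet> Y \<omega> = a"
  by (simp add: asset_values_def exp_minus)

text \<open>Holding the discounted mean in the risk-free asset leaves the centred claim as residual;
  being independent of the assets, it is uncorrelated with every portfolio value.\<close>

lemma quadratic_hedge_orthogonal_claim:
  assumes S: "S \<in> orthogonal_claims M C Y"
  shows "quadratic_hedge M Y S = (exp (- r) * expectation S, 0)"
proof (rule quadratic_hedge_eqI)
  show sq: "S \<in> square_integrable M"
    using S claims by (auto simp: orthogonal_claims_def)
  then have meas: "S \<in> borel_measurable M"
    by (simp add: square_integrable_def)
  have int: "integrable M S"
    using sq by (rule square_integrable_integrable)
  fix \<beta>
  have "expectation (\<lambda>\<omega>. (S \<omega> - expectation S) * (\<beta> \<bullet> Y \<omega>)) =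
      expectation (\<lambda>\<omega>. S \<omega> - expectation S) * expectation (\<lambda>\<omega>. \<beta> \<bullet> Y \<omega>)"
    using S int inner_payoff_integrable
    by (intro indep_set_expectation_mult(2)[where f = "\<lambda>x. x - expectation S" and g = "\<lambda>x. \<beta> \<bullet> x"]
        payoff_measurable meas)
      (auto simp: orthogonal_claims_def)
  also have "\<dots> = 0"
    using int by (simp add: prob_space)
  finally show "expectation (\<lambda>\<omega>. (S \<omega> - (exp (- r) * expectation S, 0) \<bullet> Y \<omega>) * (\<beta> \<bullet> Y \<omega>)) = 0"
    by (simp only: risk_free_inner_payoff)
qed

text \<open>Jensen's inequality conditionally on \<open>S\<close>, without conditional expectations:
  in the tangent inequality at z(S) the linear term is s(S) * (w - \<beta> \<bullet> Y), whose mean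
  is zero because \<open>S\<close> and \<open>Y\<close> are independent and \<open>w\<close> is the
  mean of \<beta> \<bullet> Y.\<close>

lemma expected_residual_loss_orthogonal_claim:
  assumes \<alpha>: "0 < \<alpha>" "\<alpha> < 1" and S: "S \<in> orthogonal_claims M C Y"
  shows "expected_residual_loss M Y \<alpha> S (exp (- r) * expectation (\<lambda>\<omega>. \<beta> \<bullet> Y \<omega>), 0)
    \<le> expected_residual_loss M Y \<alpha> S \<beta>"
proof -
  have sq: "S \<in> square_integrable M"
    using S claims by (auto simp: orthogonal_claims_def)
  then have meas [measurable]: "S \<in> borel_measurable M"
    by (simp add: square_integrable_def)
  have int: "integrable M S"
    using sq by (rule square_integrable_integrable)
  define w where "w = expectation (\<lambda>\<omega>. \<beta> \<bullet> Y \<omega>)"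
  \<comment> \<open>z(S) is the residual once the portfolio value is replaced by its mean, and s(S)
    is the slope of the loss there, a bounded function of \<open>S\<close> alone.\<close>
  define z where "z = (\<lambda>x. x - expectation S - w)"
  define s where "s x = (if 0 < z x then \<alpha> / (1 - \<alpha>) else - 1)" for x
  have [measurable]: "s \<in> borel_measurable borel"
    unfolding s_def z_def by measurable
  have s_int: "integrable M (\<lambda>\<omega>. s (S \<omega>))"
    by (rule integrable_const_bound[where B = "\<alpha> / (1 - \<alpha>) + 1"]) (use \<alpha> in \<open>auto simp: s_def z_def\<close>)
  have w_int: "integrable M (\<lambda>\<omega>. w - \<beta> \<bullet> Y \<omega>)"
    using inner_payoff_integrable by simp
  have l_int: "integrable M (\<lambda>\<omega>. quantile_loss \<alpha> (z (S \<omega>)))"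
    unfolding z_def using int by (intro quantile_loss_integrable) auto
  have l_int': "integrable M (\<lambda>\<omega>. quantile_loss \<alpha> (S \<omega> - expectation S - \<beta> \<bullet> Y \<omega>))"
    using int inner_payoff_integrable by (intro quantile_loss_integrable) auto
  have indep: "indep_set {S -` A \<inter> space M | A. A \<in> sets borel} {Y -` B \<inter> space M | B. B \<in> sets borel}"
    using S by (simp add: orthogonal_claims_def)
  note prod = indep_set_expectation_mult[OF indep meas payoff_measurable, of s "\<lambda>x. w - \<beta> \<bullet> x"]
  have prod_int: "integrable M (\<lambda>\<omega>. s (S \<omega>) * (w - \<beta> \<bullet> Y \<omega>))"
    using s_int w_int by (intro prod(1)) auto
  have "expectation (\<lambda>\<omega>. s (S \<omega>) * (w - \<beta> \<bullet> Y \<omega>)) =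
      expectation (\<lambda>\<omega>. s (S \<omega>)) * expectation (\<lambda>\<omega>. w - \<beta> \<bullet> Y \<omega>)"
    using s_int w_int by (intro prod(2)) auto
  also have "\<dots> = 0"
    using inner_payoff_integrable by (simp add: w_def prob_space)
  finally have "expectation (\<lambda>\<omega>. quantile_loss \<alpha> (z (S \<omega>))) =
      expectation (\<lambda>\<omega>. quantile_loss \<alpha> (z (S \<omega>)) + s (S \<omega>) * (w - \<beta> \<bullet> Y \<omega>))"
    using l_int prod_int by simp
  also have "\<dots> \<le> expectation (\<lambda>\<omega>. quantile_loss \<alpha> (S \<omega> - expectation S - \<beta> \<bullet> Y \<omega>))"
  proof (rule integral_mono)
    show "quantile_loss \<alpha> (z (S \<omega>)) + s (S \<omega>) * (w - \<beta> \<bullet> Y \<omega>)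
        \<le> quantile_loss \<alpha> (S \<omega> - expectation S - \<beta> \<bullet> Y \<omega>)" for \<omega>
      using quantile_loss_subgradient[OF \<alpha>, of "z (S \<omega>)" "S \<omega> - expectation S - \<beta> \<bullet> Y \<omega>"]
      by (simp add: s_def z_def)
  qed (use l_int l_int' prod_int in auto)
  finally show ?thesis
    unfolding expected_residual_loss_def quadratic_hedge_orthogonal_claim[OF S]
      risk_free_inner_payoff z_def w_def .
qed

text \<open>The risk-free replacement of the minimiser does no worse, so it is a minimiser too;
  uniqueness makes them equal.\<close>

lemma quantile_hedge_orthogonal_claim:
  assumes \<alpha>: "0 < \<alpha>" "\<alpha> < 1" and S: "S \<in> orthogonal_claims M C Y"
    and unique: "\<exists>\<^sub>\<le>\<^sub>1 \<beta>. is_arg_min (expected_residual_loss M Y \<alpha> S) (\<lambda>_. True) \<beta>"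
  shows "snd (quantile_hedge M Y \<alpha> S) = 0"
proof -
  let ?\<eta> = "quantile_hedge M Y \<alpha> S"
  have sq: "S \<in> square_integrable M"
    using S claims by (auto simp: orthogonal_claims_def)
  note \<eta> = is_arg_min_quantile_hedge[OF \<alpha> sq]
  have "is_arg_min (expected_residual_loss M Y \<alpha> S) (\<lambda>_. True)
      (exp (- r) * expectation (\<lambda>\<omega>. ?\<eta> \<bullet> Y \<omega>), 0)"
    using \<eta> expected_residual_loss_orthogonal_claim[OF \<alpha> S, of ?\<eta>]
    unfolding is_arg_min_def by (meson not_less order_trans)
  with \<eta> have "?\<eta> = (exp (- r) * expectation (\<lambda>\<omega>. ?\<eta> \<bullet> Y \<omega>), 0)"
    using unique by (auto dest: Uniq_D)
  then show ?thesis
    by (metis snd_conv)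
qed

lemma mean_quantile_valuation_orthogonal_claim:
  assumes "0 < \<alpha>" "\<alpha> < 1" "S \<in> orthogonal_claims M C Y" "y \<in> price_vectors"
    and "\<exists>\<^sub>\<le>\<^sub>1 \<beta>. is_arg_min (expected_residual_loss M Y \<alpha> S) (\<lambda>_. True) \<beta>"
  shows "mean_quantile_valuation M Y \<alpha> i y S =
    exp (- r) * expectation S + i * fst (quantile_hedge M Y \<alpha> S)"
  using assms quantile_hedge_orthogonal_claim[OF assms(1,2,3,5)]
  by (simp add: mean_quantile_valuation_def quadratic_hedge_orthogonal_claim inner_prod_def price_vectors_def)

end

section \<open>Positive homogeneity and fairness\<close>

theorem theorem2p6:
  fixes M :: "'a measure"
    and C :: "('a \<Rightarrow> real) set"
    and r \<alpha> i :: real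
    and R :: "'n::finite \<Rightarrow> 'a \<Rightarrow> real"
  defines "Y \<equiv> asset_values r R"
  assumes "market M C r R"
    and "\<alpha> \<in> {0<..<1}"
    and "i \<in> {0<..<1}"
    and "unique_quantile_hedges M C Y \<alpha>"
  shows "(\<forall>y\<in>price_vectors.
            valuation C r (mean_quantile_valuation M Y \<alpha> i y) \<and>
            positive_homogeneous C (mean_quantile_valuation M Y \<alpha> i y)) \<and>
         fair M C r Y (mean_quantile_valuation M Y \<alpha> i)"
proof -
  interpret market M C r R by fact
  have \<alpha>: "0 < \<alpha>" "\<alpha> < 1"
    using assms by auto
  have unique: "\<exists>\<^sub>\<le>\<^sub>1 \<beta>. is_arg_min (expected_residual_loss M Y \<alpha> S) (\<lambda>_. True) \<beta>" if "S \<in> C" for S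
    using assms that by (auto simp: unique_quantile_hedges_def)
  have sq: "S \<in> square_integrable M" if "S \<in> C" for S
    using claims that by blast
  have consistent: "market_consistent M C Y y (mean_quantile_valuation M Y \<alpha> i y)" for y
    unfolding market_consistent_def Y_def
    using sq mean_quantile_valuation_add_hedgeable by blast
  have "valuation C r (mean_quantile_valuation M Y \<alpha> i y)" if y: "y \<in> price_vectors" for y
    unfolding valuation_def
  proof (intro conjI ballI allI)
    show "mean_quantile_valuation M Y \<alpha> i y (\<lambda>\<omega>. 0) = 0"
      unfolding Y_def by (rule mean_quantile_valuation_zero[OF \<alpha>])
    fix S a assume "S \<in> C"
    \<comment> \<open>Constants are hedgeable with the risk-free asset, so translation by cash is a
      case of market consistency.\<close>
    have "hedged_by M Y (\<lambda>_. a) (exp (- r) * a, 0)"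
      unfolding hedged_by_def Y_def risk_free_inner_payoff by simp
    then show "mean_quantile_valuation M Y \<alpha> i y (\<lambda>\<omega>. S \<omega> + a) =
        mean_quantile_valuation M Y \<alpha> i y S + exp (- r) * a"
      using consistent[of y] \<open>S \<in> C\<close> y
      unfolding market_consistent_def by (fastforce simp: inner_prod_def price_vectors_def)
  qed
  moreover have "positive_homogeneous C (mean_quantile_valuation M Y \<alpha> i y)" for y
    unfolding positive_homogeneous_def
  proof (intro ballI allI impI)
    fix S and c :: real
    assume "S \<in> C" "0 \<le> c"
    show "mean_quantile_valuation M Y \<alpha> i y (\<lambda>\<omega>. c * S \<omega>) = c * mean_quantile_valuation M Y \<alpha> i y S"
    \<comment> \<open>Scaling of the quantile hedge divides by \<open>c\<close>; for c = 0 the value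
      of the zero claim is used instead.\<close>
    proof (cases "c = 0")
      case True
      then show ?thesis
        using mean_quantile_valuation_zero[OF \<alpha>] by (simp add: Y_def)
    next
      case False
      then have "0 < c"
        using \<open>0 \<le> c\<close> by simp
      then show ?thesis
        using quantile_hedge_scale[OF \<alpha> sq[OF \<open>S \<in> C\<close>] _ unique[OF \<open>S \<in> C\<close>, unfolded Y_def]]
          quadratic_hedge_scale[OF sq[OF \<open>S \<in> C\<close>]]
        unfolding mean_quantile_valuation_def Y_def by (simp add: algebra_simps)
    qed
  qed
  moreover have "actuarial M C r Y (mean_quantile_valuation M Y \<alpha> i)"
    unfolding actuarial_def
  \<comment> \<open>The risk margin is left open here and is read off below as
    \<open>i * fst (quantile_hedge M Y \<alpha> S)\<close>, which does not contain
    \<open>y\<close>.\<close>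
  proof (intro exI ballI)
    fix y :: "real \<times> (real ^ 'n)" and S
    assume "y \<in> price_vectors" and S: "S \<in> orthogonal_claims M C Y"
    moreover have "S \<in> C"
      using S by (simp add: orthogonal_claims_def)
    ultimately show "mean_quantile_valuation M Y \<alpha> i y S =
        exp (- r) * expectation S + i * fst (quantile_hedge M Y \<alpha> S)"
      unfolding Y_def using \<alpha> unique[unfolded Y_def] by (intro mean_quantile_valuation_orthogonal_claim)
  qed
  ultimately show ?thesis
    unfolding fair_def using consistent by blast
qed

end
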